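(* Let $u$ be a packed word of length $n$. Then $$V_u(t):=\mathbf{N}_u*(\sigma_1^t)_n=\sum_{k=1}^n t^k\,\mathbf{N}_u*E_n^{[k]}=\sum_{w\ge u}\ \prod_{i=1}^{\max(u)}\binom{t}{\max(w^{(i)})}\ \mathbf{N}_w,$$ where the sum is over packed words $w$ of length $n$ finer than $u$, and $w^{(i)}=\mathrm{pack}(w_{j_1}w_{j_2}\cdots w_{j_p})$ with $\{j_1<\dots<j_p\}=\{j: u_j=i\}$.
   Context: $\mathbb{K}$ is a field of characteristic $0$, $t$ an indeterminate. A word over the positive integers is packed if its set of letters is $\{1,\dots,r\}$ for some $r$; then $r=\max(u)$. For a word $w$ over a totally ordered alphabet with distinct letters $b_1<\dots<b_r$, $\mathrm{pack}(w)$ is obtained by replacing each $b_i$ by $i$. A packed word $u=u_1\cdots u_n$ is identified with the set composition of $\{1,\dots,n\}$ whose $i$-th block is $\{j:u_j=i\}$. For packed words $u,w$ of length $n$, $w$ is finer than $u$, written $w\ge u$, if the set composition $u$ is obtained from $w$ by merging some consecutive blocks (equivalently $w_i\le w_j\Rightarrow u_i\le u_j$ for all $i,j$). $\mathbf{WQSym}^*_n$ is the $\mathbb{K}$-vector space with basis $\mathbf{N}_u$, $u$ running over packed words of length $n$, with internal product $\mathbf{N}_u*\mathbf{N}_v=\mathbf{N}_{\mathrm{pack}\binom{u}{v}}$, where $\binom{u}{v}$ is the word of biletters $\binom{u_1}{v_1}\cdots\binom{u_n}{v_n}$, ordered lexicographically with priority to the top letter; scalars are extended to $\mathbb{K}[t]$.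 The degree $n$ component of $\sigma_1^t$ is $$(\sigma_1^t)_n=\sum_{|u|=n}\binom{t}{\max(u)}\mathbf{N}_u=\sum_{k=1}^n t^kE_n^{[k]},$$ the first sum being over all packed words of length $n$; the second equality defines the Eulerian idempotents $E_n^{[k]}$. *)

theory Defs
  imports
    "HOL-Computational_Algebra.Polynomial"
    "HOL-Library.Poly_Mapping"
    "HOL-Library.Product_Lexorder"
begin

section \<open>Packed words\<close>

definition packed :: "nat list \<Rightarrow> bool" where
  "packed u \<longleftrightarrow> (\<exists>r. set u = {1..r})"

definition packed_words :: "nat \<Rightarrow> nat list set" where
  "packed_words n = {u. packed u \<and> length u = n}"

text \<open>The number \<open>r\<close> of distinct letters of a packed word; it is \<open>0\<close> for the empty word.\<close>

definition max_letter :: "nat list \<Rightarrow> nat" where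
  "max_letter u = Max (insert 0 (set u))"

text \<open>The letter \<open>b\<^sub>i\<close> is the one with exactly \<open>i\<close> distinct letters \<open>\<le> b\<^sub>i\<close>.\<close>

definition pack :: "'b::linorder list \<Rightarrow> nat list" where
  "pack w = map (\<lambda>b. card {c \<in> set w. c \<le> b}) w"

text \<open>Positions in words are counted from \<open>0\<close>, so a word of length \<open>n\<close> gives a set composition
  of \<open>{0..<n}\<close>.\<close>

definition block :: "nat list \<Rightarrow> nat \<Rightarrow> nat set" where
  "block u i = {j. j < length u \<and> u ! j = i}"

definition set_comp :: "nat list \<Rightarrow> nat set list" where
  "set_comp u = map (block u) [1..<Suc (max_letter u)]"

definition merges_to :: "'b set list \<Rightarrow> 'b set list \<Rightarrow> bool" where
  "merges_to C D \<longleftrightarrow> (\<exists>Bs. [] \<notin> set Bs \<and> concat Bs = C \<and> map (\<lambda>B. \<Union> (set B)) Bs = D)"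

text \<open>\<open>finer w u\<close> is \<open>w \<ge> u\<close>.\<close>

definition finer :: "nat list \<Rightarrow> nat list \<Rightarrow> bool" where
  "finer w u \<longleftrightarrow> merges_to (set_comp w) (set_comp u)"

text \<open>\<open>subpack w u i\<close> is \<open>w\<^sup>(\<^sup>i\<^sup>)\<close>.\<close>

definition subpack :: "nat list \<Rightarrow> nat list \<Rightarrow> nat \<Rightarrow> nat list" where
  "subpack w u i = pack (nths w (block u i))"


section \<open>The internal product\<close>

text \<open>The free module on all words; its degree \<open>n\<close> component \<open>WQSym n\<close> is spanned by the packed
  words of length \<open>n\<close>. The coefficient ring is \<open>'k\<close> or \<open>'k poly\<close>.\<close>

definition WQSym :: "nat \<Rightarrow> (nat list \<Rightarrow>\<^sub>0 'a::comm_ring_1) set" where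
  "WQSym n = {f. Poly_Mapping.keys f \<subseteq> packed_words n}"

definition N :: "nat list \<Rightarrow> nat list \<Rightarrow>\<^sub>0 'a::comm_ring_1" where
  "N u = Poly_Mapping.single u 1"

definition smul :: "'a::comm_ring_1 \<Rightarrow> (nat list \<Rightarrow>\<^sub>0 'a) \<Rightarrow> (nat list \<Rightarrow>\<^sub>0 'a)" where
  "smul a f = Poly_Mapping.map (\<lambda>c. a * c) f"

text \<open>The bilinear extension of the product of basis elements; words of different lengths have
  product \<open>0\<close>.\<close>

definition iprod :: "(nat list \<Rightarrow>\<^sub>0 'a::comm_ring_1) \<Rightarrow> (nat list \<Rightarrow>\<^sub>0 'a) \<Rightarrow> (nat list \<Rightarrow>\<^sub>0 'a)" where
  "iprod f g = (\<Sum>u\<in>Poly_Mapping.keys f. \<Sum>v\<in>Poly_Mapping.keys g.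
     if length u = length v
     then smul (Poly_Mapping.lookup f u * Poly_Mapping.lookup g v) (N (pack (zip u v)))
     else 0)"

text \<open>Extension of scalars from \<open>'k\<close> to \<open>'k poly\<close>.\<close>

definition ext :: "(nat list \<Rightarrow>\<^sub>0 'k::field_char_0) \<Rightarrow> (nat list \<Rightarrow>\<^sub>0 'k poly)" where
  "ext f = Poly_Mapping.map (\<lambda>c. [:c:]) f"


section \<open>Powers of \<open>\<sigma>\<^sub>1\<close> and Eulerian idempotents\<close>

text \<open>The binomial coefficient \<open>t(t - 1) \<cdots> (t - m + 1) / m!\<close> as a polynomial in the indeterminate \<open>t\<close>.
  The library constant \<open>gchoose\<close> is restricted to fields and cannot be applied to \<open>t = [:0, 1:]\<close>
  itself; see \<open>poly_tbinom\<close> for the relation.\<close>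

definition tbinom :: "nat \<Rightarrow> 'k::field_char_0 poly" where
  "tbinom m = smult (inverse (fact m)) (\<Prod>i<m. [:- of_nat i, 1:])"

definition sigma :: "nat \<Rightarrow> (nat list \<Rightarrow>\<^sub>0 'k::field_char_0 poly)" where
  "sigma n = (\<Sum>u\<in>packed_words n. smul (tbinom (max_letter u)) (N u))"

text \<open>The coefficient of \<open>t\<^sup>k\<close> in \<open>sigma n\<close>; see \<open>sigma_eulerian\<close> and \<open>eulerian_unique\<close>.\<close>

definition eulerian :: "nat \<Rightarrow> nat \<Rightarrow> (nat list \<Rightarrow>\<^sub>0 'k::field_char_0)" where
  "eulerian n k = Poly_Mapping.map (\<lambda>p. coeff p k) (sigma n)"

definition V :: "nat list \<Rightarrow> (nat list \<Rightarrow>\<^sub>0 'k::field_char_0 poly)" where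
  "V u = iprod (N u) (sigma (length u))"


section \<open>Consistency of the definitions\<close>

lemma poly_tbinom: "poly (tbinom m) x = x gchoose m"
  by (simp add: tbinom_def gbinomial_prod_rev poly_prod lessThan_atLeast0 divide_inverse mult.commute)

lemma degree_tbinom: "degree (tbinom m :: 'k::field_char_0 poly) \<le> m"
proof -
  have "degree (\<Prod>i<m. [:- of_nat i, 1:] :: 'k poly) \<le> (\<Sum>i<m. 1)"
    using degree_prod_sum_le[of "{..<m}" "\<lambda>i. [:- of_nat i, 1:] :: 'k poly"] by simp
  then show ?thesis
    unfolding tbinom_def using degree_smult_le order.trans by fastforce
qed

lemma coeff_tbinom_0: "m > 0 \<Longrightarrow> coeff (tbinom m :: 'k::field_char_0 poly) 0 = 0"
  by (cases m) (auto simp: tbinom_def lessThan_Suc_eq_insert_0 prod.insert)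

lemma finite_packed_words: "finite (packed_words n)"
proof (rule finite_subset)
  show "packed_words n \<subseteq> {u. set u \<subseteq> {1..n} \<and> length u = n}"
  proof
    fix u assume "u \<in> packed_words n"
    then obtain r where r: "set u = {1..r}" "length u = n"
      by (auto simp: packed_words_def packed_def)
    then have "r \<le> n" using card_length[of u] by simp
    with r show "u \<in> {u. set u \<subseteq> {1..n} \<and> length u = n}" by auto
  qed
qed (rule finite_lists_length_eq, simp)

lemma max_letter_packed: "set u = {1..r} \<Longrightarrow> max_letter u = r"
  unfolding max_letter_def by (rule Max_eqI) auto

lemma max_letter_bounds:
  assumes "u \<in> packed_words n" "n \<ge> 1" shows "1 \<le> max_letter u" "max_letter u \<le> n"
proof -
  from assms obtain r where r: "set u = {1..r}" "length u = n"
    by (auto simp: packed_words_def packed_def)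
  then have "r \<le> n" "r \<noteq> 0" using card_length[of u] assms(2) by (auto intro!: Nat.gr0I)
  then show "1 \<le> max_letter u" "max_letter u \<le> n" using max_letter_packed[OF r(1)] by auto
qed

lemma lookup_smul: "Poly_Mapping.lookup (smul a f) w = a * Poly_Mapping.lookup f w"
  by (simp add: smul_def map.rep_eq when_def)

lemma lookup_ext: "Poly_Mapping.lookup (ext f) w = [:Poly_Mapping.lookup f w:]"
  by (simp add: ext_def map.rep_eq when_def)

lemma lookup_eulerian:
  "Poly_Mapping.lookup (eulerian n k) w = coeff (Poly_Mapping.lookup (sigma n) w) k"
  by (simp add: eulerian_def map.rep_eq when_def)

lemma lookup_sigma:
  "Poly_Mapping.lookup (sigma n) w = (if w \<in> packed_words n then tbinom (max_letter w) else 0)"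
proof -
  have "Poly_Mapping.lookup (sigma n :: nat list \<Rightarrow>\<^sub>0 'a poly) w
      = (\<Sum>u\<in>packed_words n. if u = w then tbinom (max_letter w) else 0)"
    unfolding sigma_def lookup_sum
    by (rule sum.cong) (auto simp: lookup_smul N_def lookup_single when_def)
  then show ?thesis by (simp add: finite_packed_words)
qed

lemma sigma_eulerian:
  assumes "n \<ge> 1"
  shows "(sigma n :: nat list \<Rightarrow>\<^sub>0 'k::field_char_0 poly)
    = (\<Sum>k=1..n. smul (monom 1 k) (ext (eulerian n k)))"
proof (rule poly_mapping_eqI, rule poly_eqI)
  fix w i
  let ?s = "Poly_Mapping.lookup (sigma n :: nat list \<Rightarrow>\<^sub>0 'k poly) w"
  have z: "coeff ?s i = 0" if "i = 0 \<or> i > n"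
  proof (cases "w \<in> packed_words n")
    case True
    from max_letter_bounds[OF True assms] degree_tbinom[of "max_letter w", where 'k = 'k]
    show ?thesis using that True by (cases "i = 0") (auto simp: lookup_sigma coeff_tbinom_0 coeff_eq_0)
  qed (simp add: lookup_sigma)
  have "coeff (Poly_Mapping.lookup (\<Sum>k=1..n. smul (monom 1 k) (ext (eulerian n k))) w) i
      = (\<Sum>k=1..n. if k = i then coeff ?s i else 0)"
    unfolding lookup_sum coeff_sum
    by (rule sum.cong)
      (auto simp: lookup_smul lookup_ext lookup_eulerian coeff_monom_mult coeff_pCons split: nat.split)
  also have "\<dots> = coeff ?s i" using z by (cases "i = 0 \<or> i > n") auto
  finally show "coeff ?s i
      = coeff (Poly_Mapping.lookup (\<Sum>k=1..n. smul (monom 1 k) (ext (eulerian n k))) w) i" ..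
qed

lemma eulerian_unique:
  fixes e :: "nat \<Rightarrow> nat list \<Rightarrow>\<^sub>0 'k::field_char_0"
  assumes "sigma n = (\<Sum>k=1..n. smul (monom 1 k) (ext (e k)))" "k \<in> {1..n}"
  shows "e k = eulerian n k"
proof (rule poly_mapping_eqI)
  fix w
  have "Poly_Mapping.lookup (eulerian n k) w
      = (\<Sum>i=1..n. if i = k then Poly_Mapping.lookup (e k) w else 0)"
    unfolding lookup_eulerian assms(1) lookup_sum coeff_sum
    by (rule sum.cong)
      (auto simp: lookup_smul lookup_ext coeff_monom_mult coeff_pCons split: nat.split)
  then show "Poly_Mapping.lookup (e k) w = Poly_Mapping.lookup (eulerian n k) w"
    using assms(2) by simp
qed

lemma pack_packed: "packed (pack w)"
proof -
  let ?c = "\<lambda>b. card {c \<in> set w. c \<le> b}"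
  have "inj_on ?c (set w)"
  proof (rule linorder_inj_onI')
    fix a b assume "a \<in> set w" "b \<in> set w" "a < b"
    then have "{c \<in> set w. c \<le> a} \<subseteq> {c \<in> set w. c \<le> b}" "b \<in> {c \<in> set w. c \<le> b}"
      "b \<notin> {c \<in> set w. c \<le> a}" by auto
    then have "{c \<in> set w. c \<le> a} \<subset> {c \<in> set w. c \<le> b}" by blast
    then have "?c a < ?c b" by (intro psubset_card_mono) simp_all
    then show "?c a \<noteq> ?c b" by (rule less_imp_neq)
  qed
  moreover have "?c ` set w \<subseteq> {1..card (set w)}"
    by (auto simp: Suc_le_eq card_gt_0_iff intro!: card_mono)
  ultimately have "?c ` set w = {1..card (set w)}"
    by (intro card_subset_eq) (auto simp: card_image)
  then show ?thesis by (auto simp: packed_def pack_def)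
qed

lemma smul_N_WQSym: "w \<in> packed_words n \<Longrightarrow> smul a (N w) \<in> WQSym n"
  by (auto simp: WQSym_def N_def lookup_smul lookup_single in_keys_iff when_def split: if_splits)

lemma sum_WQSym: "(\<And>x. x \<in> A \<Longrightarrow> f x \<in> WQSym n) \<Longrightarrow> sum f A \<in> WQSym n"
proof -
  assume f: "\<And>x. x \<in> A \<Longrightarrow> f x \<in> WQSym n"
  have "Poly_Mapping.keys (sum f A) \<subseteq> (\<Union>x\<in>A. Poly_Mapping.keys (f x))" by (rule keys_sum)
  with f show ?thesis by (fastforce simp: WQSym_def)
qed

lemma iprod_WQSym:
  assumes "f \<in> WQSym n" "g \<in> WQSym n" shows "iprod f g \<in> WQSym n"
  unfolding iprod_def
proof (intro sum_WQSym)
  fix u v assume "u \<in> Poly_Mapping.keys f" "v \<in> Poly_Mapping.keys g"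
  with assms have "length u = n" "length v = n" by (auto simp: WQSym_def packed_words_def)
  then have "pack (zip u v) \<in> packed_words n"
    by (simp add: packed_words_def pack_packed) (simp add: pack_def)
  then show "(if length u = length v
     then smul (Poly_Mapping.lookup f u * Poly_Mapping.lookup g v) (N (pack (zip u v)))
     else 0) \<in> WQSym n"
    by (simp add: smul_N_WQSym) (simp add: WQSym_def)
qed

lemma sigma_WQSym: "sigma n \<in> WQSym n"
  unfolding sigma_def by (intro sum_WQSym smul_N_WQSym)

lemma eulerian_WQSym: "eulerian n k \<in> WQSym n"
  by (auto simp: WQSym_def in_keys_iff lookup_eulerian lookup_sigma split: if_splits)

lemma merge_index:
  "\<exists>g. \<forall>k<length (concat Bs). g k < length Bs \<and> concat Bs ! k \<in> set (Bs ! g k) \<and>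
     (\<forall>l\<le>k. g l \<le> (g k :: nat))"
proof (induction Bs)
  case (Cons B Bs)
  then obtain g where g: "\<forall>k<length (concat Bs). g k < length Bs \<and>
    concat Bs ! k \<in> set (Bs ! g k) \<and> (\<forall>l\<le>k. g l \<le> (g k :: nat))" by blast
  show ?case
    by (rule exI[of _ "\<lambda>k. if k < length B then 0 else Suc (g (k - length B))"])
      (use g in \<open>auto simp: nth_append\<close>)
qed simp

lemma concat_filter_sorted:
  fixes f :: "'b \<Rightarrow> nat"
  assumes "sorted (map f xs)" "\<forall>x\<in>set xs. 1 \<le> f x \<and> f x \<le> r"
  shows "concat (map (\<lambda>i. filter (\<lambda>x. f x = i) xs) [1..<Suc r]) = xs"
  using assms
proof (induction r arbitrary: xs)
  case 0
  then show ?case by (cases xs) auto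
next
  case (Suc r)
  have split: "filter (\<lambda>x. f x \<le> r) ys @ filter (\<lambda>x. f x = Suc r) ys = ys"
    if "sorted (map f ys)" "\<forall>x\<in>set ys. f x \<le> Suc r" for ys
    using that
  proof (induction ys)
    case (Cons y ys)
    show ?case
    proof (cases "f y \<le> r")
      case True
      with Cons show ?thesis by auto
    next
      case False
      with Cons.prems have "\<forall>x\<in>set (y # ys). f x = Suc r" by (auto simp: le_antisym)
      then show ?thesis by (auto simp: filter_empty_conv filter_id_conv)
    qed
  qed simp
  let ?ys = "filter (\<lambda>x. f x \<le> r) xs"
  have "concat (map (\<lambda>i. filter (\<lambda>x. f x = i) ?ys) [1..<Suc r]) = ?ys"
    by (rule Suc.IH) (use Suc.prems in \<open>auto simp: sorted_filter\<close>)
  moreover have "map (\<lambda>i. filter (\<lambda>x. f x = i) ?ys) [1..<Suc r]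
      = map (\<lambda>i. filter (\<lambda>x. f x = i) xs) [1..<Suc r]"
    by (auto intro!: filter_cong)
  ultimately have "concat (map (\<lambda>i. filter (\<lambda>x. f x = i) xs) [1..<Suc r]) = ?ys"
    by (simp only:)
  moreover have "[1..<Suc (Suc r)] = [1..<Suc r] @ [Suc r]" by simp
  ultimately show ?case using split[of xs] Suc.prems by (simp del: upt_Suc)
qed

lemma finer_iff:
  assumes "w \<in> packed_words n" "u \<in> packed_words n"
  shows "finer w u \<longleftrightarrow> (\<forall>i<n. \<forall>j<n. w ! i \<le> w ! j \<longrightarrow> u ! i \<le> u ! j)"
proof -
  from assms obtain s r where w: "set w = {1..s}" "length w = n" and u: "set u = {1..r}" "length u = n"
    by (auto simp: packed_words_def packed_def)
  have sw: "set_comp w = map (block w) [1..<Suc s]" and su: "set_comp u = map (block u) [1..<Suc r]"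
    using max_letter_packed[OF w(1)] max_letter_packed[OF u(1)] by (auto simp: set_comp_def)
  have rw: "1 \<le> w ! j" "w ! j \<le> s" and ru: "1 \<le> u ! j" "u ! j \<le> r" if "j < n" for j
    using nth_mem[of j w] nth_mem[of j u] that w u by auto
  show ?thesis
  proof
    assume "finer w u"
    then obtain Bs where B: "concat Bs = set_comp w" "map (\<lambda>B. \<Union> (set B)) Bs = set_comp u"
      by (auto simp: finer_def merges_to_def)
    obtain g where g: "\<forall>k<length (concat Bs). g k < length Bs \<and>
      concat Bs ! k \<in> set (Bs ! g k) \<and> (\<forall>l\<le>k. g l \<le> (g k :: nat))"
      using merge_index by blast
    have len: "length (concat Bs) = s" "length Bs = r"
      using B(1) arg_cong[OF B(2), of length] by (auto simp: sw su)
    have gu: "u ! j = Suc (g (w ! j - 1))" if j: "j < n" for j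
    proof -
      let ?k = "w ! j - 1"
      have k: "?k < s" using rw[OF j] by linarith
      have "concat Bs ! ?k = block w (w ! j)"
        unfolding B(1) sw using k rw[OF j] by (simp del: upt_Suc)
      then have "j \<in> concat Bs ! ?k" using j w by (simp add: block_def)
      moreover have "g ?k < r" "concat Bs ! ?k \<in> set (Bs ! g ?k)" using g k len by auto
      ultimately have "j \<in> map (\<lambda>B. \<Union> (set B)) Bs ! g ?k" using len by auto
      then have "j \<in> block u (Suc (g ?k))"
        unfolding B(2) su using \<open>g ?k < r\<close> by (simp del: upt_Suc)
      then show ?thesis by (simp add: block_def)
    qed
    show "\<forall>i<n. \<forall>j<n. w ! i \<le> w ! j \<longrightarrow> u ! i \<le> u ! j"
    proof (intro allI impI)
      fix i j assume ij: "i < n" "j < n" "w ! i \<le> w ! j"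
      then have "w ! j - 1 < s" using rw[of j] by linarith
      then have "g (w ! i - 1) \<le> g (w ! j - 1)" using g ij(3) len diff_le_mono by blast
      then show "u ! i \<le> u ! j" using gu ij by simp
    qed
  next
    assume mono: "\<forall>i<n. \<forall>j<n. w ! i \<le> w ! j \<longrightarrow> u ! i \<le> u ! j"
    define p where "p c = (SOME j. j < n \<and> w ! j = c)" for c
    have p: "p c < n" "w ! p c = c" if "c \<in> {1..s}" for c
    proof -
      have "\<exists>j. j < n \<and> w ! j = c" using that w by (metis in_set_conv_nth)
      from someI_ex[OF this] show "p c < n" "w ! p c = c" by (auto simp: p_def)
    qed
    define f where "f c = u ! p c" for c
    have fw: "f (w ! j) = u ! j" if "j < n" for j
      using p[of "w ! j"] rw[OF that] mono that by (auto simp: f_def intro!: le_antisym)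
    have fmono: "f c \<le> f d" if "c \<in> {1..s}" "d \<in> {1..s}" "c \<le> d" for c d
      using p[OF that(1)] p[OF that(2)] mono that(3) by (auto simp: f_def)
    define L where "L i = filter (\<lambda>c. f c = i) [1..<Suc s]" for i
    have cat: "concat (map L [1..<Suc r]) = [1..<Suc s]"
      unfolding L_def
    proof (rule concat_filter_sorted)
      show "sorted (map f [1..<Suc s])"
        unfolding sorted_map by (rule sorted_wrt_mono_rel[OF _ sorted_upt]) (auto intro!: fmono)
      show "\<forall>x\<in>set [1..<Suc s]. 1 \<le> f x \<and> f x \<le> r" using p ru by (auto simp: f_def)
    qed
    define Bs where "Bs = map (\<lambda>i. map (block w) (L i)) [1..<Suc r]"
    have "concat Bs = map (block w) (concat (map L [1..<Suc r]))"
      by (simp add: Bs_def map_concat comp_def del: upt_Suc)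
    then have 1: "concat Bs = set_comp w" by (simp only: cat sw)
    have "(\<Union>c\<in>set (L i). block w c) = block u i" for i
      using rw fw u w by (auto simp: L_def block_def less_Suc_eq_le simp del: upt_Suc)
    then have 2: "map (\<lambda>B. \<Union> (set B)) Bs = set_comp u"
      by (simp add: Bs_def su del: upt_Suc)
    have "L i \<noteq> []" if i: "i \<in> {1..r}" for i
    proof -
      obtain j where "j < n" "u ! j = i" using i u by (metis in_set_conv_nth)
      then have "w ! j \<in> set (L i)" using fw rw by (auto simp: L_def less_Suc_eq_le simp del: upt_Suc)
      then show ?thesis by auto
    qed
    then have 3: "[] \<notin> set Bs" by (auto simp: Bs_def simp del: upt_Suc)
    show "finer w u" unfolding finer_def merges_to_def using 1 2 3 by blast
  qed
qed

end

(* At a natural number t = m, binom(m, max(v)) is the number of words x over {0,...,m-1} with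
   pack(x) = v. As pack(u over x) depends on x only through pack(x), the coefficient of N_w in V_u
   at t = m counts the words x with pack(u over x) = w. For w finer than u this condition says
   that, for every i, the subword of x on the i-th block of u packs to w^(i); these conditions are
   independent, which gives the product of binomial coefficients. Two polynomials that agree at
   all natural numbers are equal. *)

theory Submission
  imports Defs "HOL-Library.FuncSet"
begin

section \<open>Packing and the order of letters\<close>

lemma length_pack [simp]: "length (pack w) = length w"
  by (simp add: pack_def)

text \<open>A larger letter has strictly more letters below or equal to it, because it counts
  itself. Hence packing preserves and reflects every comparison.\<close>

lemma pack_nth_le_iff:
  assumes "i < length w" "j < length w"
  shows "pack w ! i \<le> pack w ! j \<longleftrightarrow> w ! i \<le> w ! j"
proof
  assume "w ! i \<le> w ! j"
  then show "pack w ! i \<le> pack w ! j"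
    using assms by (auto simp: pack_def intro!: card_mono)
next
  assume le: "pack w ! i \<le> pack w ! j"
  show "w ! i \<le> w ! j"
  proof (rule ccontr)
    assume "\<not> w ! i \<le> w ! j"
    then have "{c \<in> set w. c \<le> w ! j} \<subset> {c \<in> set w. c \<le> w ! i}"
      using assms nth_mem[of i w] by fastforce
    then have "card {c \<in> set w. c \<le> w ! j} < card {c \<in> set w. c \<le> w ! i}"
      by (intro psubset_card_mono) simp_all
    with le assms show False by (simp add: pack_def)
  qed
qed

text \<open>A letter \<open>c\<close> is encoded by the set of positions whose letter is at most
  \<open>c\<close>. This expresses the packed letter through comparisons between positions alone, so
  that words over different alphabets can be compared.\<close>

lemma card_letters_le:
  fixes w :: "'b::linorder list"
  assumes "j < length w"
  shows "card {c \<in> set w. c \<le> w ! j} =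
    card ((\<lambda>i. {k. k < length w \<and> w ! k \<le> w ! i}) ` {i. i < length w \<and> w ! i \<le> w ! j})"
proof -
  let ?g = "\<lambda>c. {k. k < length w \<and> w ! k \<le> c}"
  have "inj_on ?g (set w)"
  proof (rule inj_onI)
    fix a b assume ab: "a \<in> set w" "b \<in> set w" and eq: "?g a = ?g b"
    from ab obtain i j where ij: "i < length w" "w ! i = a" "j < length w" "w ! j = b"
      by (metis in_set_conv_nth)
    then have "i \<in> ?g a" "j \<in> ?g b" by auto
    then have "i \<in> ?g b" "j \<in> ?g a" using eq by blast+
    then show "a = b" using ij by auto
  qed
  then have "inj_on ?g {c \<in> set w. c \<le> w ! j}" by (rule inj_on_subset) auto
  then have "card {c \<in> set w. c \<le> w ! j} = card (?g ` {c \<in> set w. c \<le> w ! j})"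
    by (simp add: card_image)
  moreover have "{c \<in> set w. c \<le> w ! j} = (\<lambda>i. w ! i) ` {i. i < length w \<and> w ! i \<le> w ! j}"
    by (auto simp: in_set_conv_nth)
  ultimately show ?thesis by (simp only: image_image)
qed

text \<open>By \<open>card_letters_le\<close> the comparisons between positions determine the packed
  word, and by \<open>pack_nth_le_iff\<close> they can be recovered from it. The two alphabets may
  differ: a word of biletters will be compared with a word of numbers.\<close>

lemma pack_eq_iff:
  fixes x :: "'b::linorder list" and y :: "'c::linorder list"
  shows "pack x = pack y \<longleftrightarrow> length x = length y \<and>
    (\<forall>i<length x. \<forall>j<length x. x ! i \<le> x ! j \<longleftrightarrow> y ! i \<le> y ! j)"
proof
  assume eq: "pack x = pack y"
  then have "length x = length y" by (metis length_pack)
  with eq show "length x = length y \<and>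
    (\<forall>i<length x. \<forall>j<length x. x ! i \<le> x ! j \<longleftrightarrow> y ! i \<le> y ! j)"
    using pack_nth_le_iff[of _ x] pack_nth_le_iff[of _ y] by metis
next
  assume H: "length x = length y \<and>
    (\<forall>i<length x. \<forall>j<length x. x ! i \<le> x ! j \<longleftrightarrow> y ! i \<le> y ! j)"
  show "pack x = pack y"
  proof (rule nth_equalityI)
    show "length (pack x) = length (pack y)" using H by simp
    fix j assume "j < length (pack x)"
    then have j: "j < length x" "j < length y" using H by auto
    have "(\<lambda>i. {k. k < length x \<and> x ! k \<le> x ! i}) ` {i. i < length x \<and> x ! i \<le> x ! j}
        = (\<lambda>i. {k. k < length y \<and> y ! k \<le> y ! i}) ` {i. i < length y \<and> y ! i \<le> y ! j}"
      using H j by (intro image_cong) auto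
    then show "pack x ! j = pack y ! j"
      using j by (simp add: pack_def card_letters_le)
  qed
qed

lemma pack_id: "packed w \<Longrightarrow> pack w = w"
proof -
  assume "packed w"
  then obtain r where r: "set w = {1..r}" by (auto simp: packed_def)
  have "card {c \<in> set w. c \<le> b} = b" if "b \<in> set w" for b
  proof -
    have "{c \<in> set w. c \<le> b} = {1..b}" using that by (auto simp: r)
    then show ?thesis by simp
  qed
  then show ?thesis by (simp add: pack_def map_idI)
qed

lemma set_packed: "packed w \<Longrightarrow> set w = {1..max_letter w}"
  using max_letter_packed by (auto simp: packed_def)

text \<open>Packing is injective on letters, so it keeps the number of distinct letters, and in a
  packed word that number is the greatest letter.\<close>

lemma max_letter_pack: "max_letter (pack w) = card (set w)"
proof -
  have "inj_on (\<lambda>b. card {c \<in> set w. c \<le> b}) (set w)"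
  proof (rule inj_onI)
    fix a b assume ab: "a \<in> set w" "b \<in> set w"
      and eq: "card {c \<in> set w. c \<le> a} = card {c \<in> set w. c \<le> b}"
    from ab obtain i j where ij: "i < length w" "j < length w" "a = w ! i" "b = w ! j"
      by (metis in_set_conv_nth)
    with eq have "pack w ! i = pack w ! j" by (simp add: pack_def)
    then show "a = b"
      using pack_nth_le_iff[of i w j] pack_nth_le_iff[of j w i] ij by auto
  qed
  then have "card (set (pack w)) = card (set w)" by (simp add: pack_def card_image)
  then show ?thesis using set_packed[OF pack_packed[of w]] by simp
qed


section \<open>Counting words with given packing\<close>

lemma finite_words: "finite {x. set x \<subseteq> {..<m::nat} \<and> pack x = v}"
  by (rule finite_subset[OF _ finite_lists_length_eq[of "{..<m}" "length v"]]) auto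

text \<open>Once the packing is fixed, a word is determined by its set of letters, and every subset
  of \<open>{..<m}\<close> with \<open>max_letter v\<close> elements occurs as such a set.\<close>

lemma card_words_pack:
  assumes "packed v"
  shows "card {x. set x \<subseteq> {..<m} \<and> pack x = v} = m choose max_letter v"
proof -
  let ?r = "max_letter v"
  have "bij_betw set {x. set x \<subseteq> {..<m} \<and> pack x = v} {S. S \<subseteq> {..<m} \<and> card S = ?r}"
  proof (rule bij_betw_imageI)
    show "inj_on set {x. set x \<subseteq> {..<m} \<and> pack x = v}"
    proof (rule inj_onI)
      fix x y assume xy: "x \<in> {x. set x \<subseteq> {..<m} \<and> pack x = v}"
        "y \<in> {x. set x \<subseteq> {..<m} \<and> pack x = v}" "set x = set y"
      then have len: "length x = length y" and p: "pack x = pack y" by (auto dest: arg_cong[of _ _ length])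
      show "x = y"
      proof (rule nth_equalityI[OF len])
        fix j assume j: "j < length x"
        let ?f = "\<lambda>b. card {c \<in> set x. c \<le> b}"
        \<comment> \<open>Both letters are ranked inside \<open>set x\<close>; this is also the
          ranking of \<open>y\<close>, as the two letter sets coincide.\<close>
        have f: "?f (x ! j) = ?f (y ! j)"
          using arg_cong[OF p, of "\<lambda>l. l ! j"] j len xy(3) by (simp add: pack_def)
        have "y ! j \<in> set x" using j len xy(3) by simp
        then obtain k where k: "k < length x" "x ! k = y ! j" by (metis in_set_conv_nth)
        then have "pack x ! j = pack x ! k" using f j by (simp add: pack_def)
        then have "x ! j = x ! k"
          using pack_nth_le_iff[of j x k] pack_nth_le_iff[of k x j] j k by auto
        with k show "x ! j = y ! j" by simp
      qed
    qed
    show "set ` {x. set x \<subseteq> {..<m} \<and> pack x = v} = {S. S \<subseteq> {..<m} \<and> card S = ?r}"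
    proof (intro equalityI subsetI)
      fix S assume "S \<in> set ` {x. set x \<subseteq> {..<m} \<and> pack x = v}"
      then show "S \<in> {S. S \<subseteq> {..<m} \<and> card S = ?r}" by (auto simp: max_letter_pack)
    next
      fix S assume "S \<in> {S. S \<subseteq> {..<m} \<and> card S = ?r}"
      then have S: "S \<subseteq> {..<m}" "card S = ?r" "finite S" by (auto intro: finite_subset)
      let ?l = "sorted_list_of_set S"
      \<comment> \<open>The preimage of \<open>S\<close> replaces the letter \<open>i\<close> of
        \<open>v\<close> by the \<open>i\<close>-th smallest element of \<open>S\<close>; the shift
        is there because packed letters start at 1 and list indices at 0.\<close>
      let ?x = "map (\<lambda>i. ?l ! (i - 1)) v"
      have v: "set v = {1..?r}" using set_packed[OF assms] .
      have "(\<lambda>i. i - 1) ` {1..?r} = {..<?r}"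
      proof -
        have "i \<in> (\<lambda>i. i - 1) ` {1..?r}" if "i < ?r" for i
          using that by (intro image_eqI[of _ _ "Suc i"]) auto
        then show ?thesis by auto
      qed
      then have "set ?x = (\<lambda>i. ?l ! i) ` {..<?r}"
        by (metis image_image set_map v)
      also have "\<dots> = set ?l" using S by (auto simp: set_conv_nth)
      finally have sx: "set ?x = S" using S by simp
      have mono: "?l ! (a - 1) \<le> ?l ! (b - 1) \<longleftrightarrow> a \<le> b" if "a \<in> {1..?r}" "b \<in> {1..?r}" for a b
      proof -
        have "?l ! (a - 1) < ?l ! (b - 1)" if "a \<in> {1..?r}" "b \<in> {1..?r}" "a < b" for a b
          using that S
          by (intro sorted_wrt_nth_less[OF strict_sorted_list_of_set]) auto
        from this[of a b] this[of b a] that show ?thesis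
          by (metis leD le_less_linear linorder_neqE_nat order.order_iff_strict)
      qed
      have vn: "v ! i \<in> {1..?r}" if "i < length v" for i using v that nth_mem by blast
      have "pack ?x = pack v" unfolding pack_eq_iff
        using mono[OF vn vn] by (auto simp del: One_nat_def)
      then show "S \<in> set ` {x. set x \<subseteq> {..<m} \<and> pack x = v}"
        using sx S pack_id[OF assms] by (intro image_eqI[of _ _ ?x]) auto
    qed
  qed
  then show ?thesis by (simp add: bij_betw_same_card n_subsets)
qed

section \<open>Splitting a word along the blocks of a packed word\<close>

lemma nths_conv_map: "nths xs A = map (\<lambda>i. xs ! i) (filter (\<lambda>i. i \<in> A) [0..<length xs])"
proof -
  have "zip xs [0..<length xs] = map (\<lambda>i. (xs ! i, i)) [0..<length xs]"
    by (intro nth_equalityI) auto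
  then show ?thesis by (simp add: nths_def filter_map o_def)
qed

text \<open>A block listed in increasing order: subwords of different words on the same block become
  maps over one common index list.\<close>

definition positions :: "nat list \<Rightarrow> nat \<Rightarrow> nat list" where
  "positions u i = filter (\<lambda>j. u ! j = i) [0..<length u]"

lemma nths_block:
  "length x = length u \<Longrightarrow> nths x (block u i) = map (\<lambda>j. x ! j) (positions u i)"
  by (auto simp: nths_conv_map positions_def block_def intro!: arg_cong[of _ _ "map ((!) x)"] filter_cong)

lemma set_positions: "set (positions u i) = {j. j < length u \<and> u ! j = i}"
  by (auto simp: positions_def)

lemma distinct_positions: "distinct (positions u i)"
  by (simp add: positions_def)

lemma pack_map_eq_iff:
  fixes x :: "nat \<Rightarrow> 'b::linorder" and y :: "nat \<Rightarrow> 'c::linorder"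
  shows "pack (map x ps) = pack (map y ps) \<longleftrightarrow>
    (\<forall>a\<in>set ps. \<forall>b\<in>set ps. x a \<le> x b \<longleftrightarrow> y a \<le> y b)"
  by (simp add: pack_eq_iff all_set_conv_all_nth)

text \<open>The blocks partition the positions, so choosing \<open>x\<close> amounts to choosing its
  subwords on the blocks independently. The inclusion \<open>set u \<subseteq> I\<close> ensures
  that every position is covered, and the length hypothesis that the chosen subwords fit into their
  blocks.\<close>

lemma card_words_blockwise:
  assumes "finite I" "set u \<subseteq> I" "\<And>i. i \<in> I \<Longrightarrow> length (z i) = length (positions u i)"
  shows "card {x. length x = length u \<and> set x \<subseteq> {..<m::nat} \<and>
      (\<forall>i\<in>I. pack (nths x (block u i)) = z i)}
    = (\<Prod>i\<in>I. card {y. set y \<subseteq> {..<m} \<and> pack y = z i})"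
    (is "card ?X = _")
proof -
  let ?Y = "\<lambda>i. {y. set y \<subseteq> {..<m} \<and> pack y = z i}"
  \<comment> \<open>Restricting the family to \<open>I\<close> makes it extensional, as membership
    in \<open>PiE\<close> demands.\<close>
  let ?F = "\<lambda>x. \<lambda>i\<in>I. map (\<lambda>j. x ! j) (positions u i)"
  have uI: "u ! j \<in> I" if "j < length u" for j using assms(2) that by auto
  have "bij_betw ?F ?X (PiE I ?Y)"
  proof (rule bij_betw_imageI)
    show "inj_on ?F ?X"
    proof (rule inj_onI)
      fix x y assume x: "x \<in> ?X" and y: "y \<in> ?X" and eq: "?F x = ?F y"
      show "x = y"
      proof (rule nth_equalityI)
        show "length x = length y" using x y by simp
        fix j assume "j < length x"
        then have j: "j < length u" using x by simp
        have "map (\<lambda>j. x ! j) (positions u (u ! j)) = map (\<lambda>j. y ! j) (positions u (u ! j))"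
          using fun_cong[OF eq, of "u ! j"] uI[OF j] by simp
        moreover have "j \<in> set (positions u (u ! j))" using j by (simp add: set_positions)
        ultimately show "x ! j = y ! j" by (simp add: map_eq_conv)
      qed
    qed
    show "?F ` ?X = PiE I ?Y"
    proof (intro equalityI subsetI)
      fix g assume "g \<in> ?F ` ?X"
      then obtain x where x: "x \<in> ?X" "g = ?F x" by blast
      show "g \<in> PiE I ?Y"
      proof (rule PiE_I)
        fix i assume i: "i \<in> I"
        have "set (map (\<lambda>j. x ! j) (positions u i)) \<subseteq> set x" using x by (auto simp: set_positions)
        then show "g i \<in> ?Y i" using x i nths_block[of x u i] by auto
      qed (use x in auto)
    next
      fix g assume g: "g \<in> PiE I ?Y"
      have len: "length (g i) = length (positions u i)" if "i \<in> I" for i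
        using g that assms(3)[OF that] length_pack[of "g i"] by (auto simp: PiE_iff)
      \<comment> \<open>Gluing: the letter at \<open>j\<close> is read from the word chosen for the
        block of \<open>j\<close>, at the rank of \<open>j\<close> in that block. The association
        list inverts the enumeration \<open>positions\<close>; the lookup succeeds because
        \<open>j\<close> lies in its own block and the lengths agree.\<close>
      define x where "x = map (\<lambda>j. the (map_of (zip (positions u (u ! j)) (g (u ! j))) j)) [0..<length u]"
      have restr: "map (\<lambda>j. x ! j) (positions u i) = g i" if i: "i \<in> I" for i
      proof (rule nth_equalityI)
        show "length (map (\<lambda>j. x ! j) (positions u i)) = length (g i)" using len[OF i] by simp
        fix k assume "k < length (map (\<lambda>j. x ! j) (positions u i))"
        then have k: "k < length (positions u i)" by simp
        then have "positions u i ! k \<in> set (positions u i)" by simp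
        then have p: "positions u i ! k < length u" "u ! (positions u i ! k) = i"
          by (auto simp: set_positions)
        have "map_of (zip (positions u i) (g i)) (positions u i ! k) = Some (g i ! k)"
          using len[OF i] k by (intro map_of_zip_nth) (auto simp: distinct_positions)
        then show "map (\<lambda>j. x ! j) (positions u i) ! k = g i ! k" using k p by (simp add: x_def)
      qed
      have lx: "length x = length u" by (simp add: x_def)
      have "x ! j < m" if j: "j < length u" for j
      proof -
        have "x ! j \<in> set (map (\<lambda>j. x ! j) (positions u (u ! j)))" using j by (auto simp: set_positions)
        also have "\<dots> = set (g (u ! j))" using restr uI[OF j] by simp
        also have "\<dots> \<subseteq> {..<m}" using g uI[OF j] by (auto simp: PiE_iff)
        finally show ?thesis by simp
      qed
      then have "set x \<subseteq> {..<m}" using lx by (auto simp: in_set_conv_nth)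
      then have "x \<in> ?X" using lx g restr by (auto simp: nths_block PiE_iff)
      moreover have "g = ?F x" using g restr by (auto simp: fun_eq_iff PiE_iff extensional_def)
      ultimately show "g \<in> ?F ` ?X" by blast
    qed
  qed
  then show ?thesis using assms(1) by (simp add: bij_betw_same_card card_PiE)
qed


section \<open>Coefficients of the internal product\<close>

text \<open>The lexicographic order on biletters sees the bottom word only through comparisons
  between its letters, and packing preserves these.\<close>

lemma pack_zip_pack:
  assumes "length u = length x"
  shows "pack (zip u (pack x)) = pack (zip u x)"
  using assms by (auto simp: pack_eq_iff less_eq_prod_def pack_nth_le_iff)

text \<open>Since the top letter has priority, ordered biletters have ordered top letters, which is
  the criterion of \<open>finer_iff\<close>. Consequently only words finer than \<open>u\<close> can
  occur in \<open>V u\<close>.\<close>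

lemma finer_pack_zip:
  assumes "u \<in> packed_words n" "length x = n"
  shows "finer (pack (zip u x)) u"
proof -
  have "pack (zip u x) \<in> packed_words n"
    using assms pack_packed[of "zip u x"] by (simp add: packed_words_def)
  then show ?thesis using assms
    by (auto simp: finer_iff packed_words_def pack_nth_le_iff less_eq_prod_def)
qed

text \<open>For positions in different blocks of \<open>u\<close>, the top letters decide the
  comparison of biletters, and fineness forces the same comparison in \<open>w\<close>. Only
  comparisons inside one block remain, and these are recorded by the packed subwords.\<close>

lemma pack_zip_eq_iff:
  assumes u: "u \<in> packed_words n" and w: "w \<in> packed_words n" and f: "finer w u"
    and x: "length x = n"
  shows "pack (zip u x) = w \<longleftrightarrow>
    (\<forall>i\<in>{1..max_letter u}. pack (nths x (block u i)) = subpack w u i)"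
proof -
  have lu: "length u = n" and lw: "length w = n" using u w by (auto simp: packed_words_def)
  have mono: "u ! i \<le> u ! j" if "i < n" "j < n" "w ! i \<le> w ! j" for i j
    using f that by (auto simp: finer_iff[OF w u])
  have range: "u ! j \<in> {1..max_letter u}" if "j < n" for j
    using set_packed[of u] u that lu by (auto simp: packed_words_def dest: nth_mem)
  have "pack (zip u x) = w \<longleftrightarrow> pack (zip u x) = pack w"
    using w by (simp add: pack_id packed_words_def)
  also have "\<dots> \<longleftrightarrow> (\<forall>a<n. \<forall>b<n. (u ! a, x ! a) \<le> (u ! b, x ! b) \<longleftrightarrow> w ! a \<le> w ! b)"
    using lu lw x by (auto simp: pack_eq_iff)
  also have "\<dots> \<longleftrightarrow> (\<forall>a<n. \<forall>b<n. u ! a = u ! b \<longrightarrow> (x ! a \<le> x ! b \<longleftrightarrow> w ! a \<le> w ! b))"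
  proof -
    have "((u ! a, x ! a) \<le> (u ! b, x ! b) \<longleftrightarrow> w ! a \<le> w ! b) \<longleftrightarrow>
        (u ! a = u ! b \<longrightarrow> (x ! a \<le> x ! b \<longleftrightarrow> w ! a \<le> w ! b))" if "a < n" "b < n" for a b
      using mono[of a b] mono[of b a] that linear[of "w ! a" "w ! b"]
      by (cases "u ! a" "u ! b" rule: linorder_cases) (auto simp: less_eq_prod_def)
    then show ?thesis by blast
  qed
  also have "\<dots> \<longleftrightarrow> (\<forall>i\<in>{1..max_letter u}. pack (nths x (block u i)) = subpack w u i)"
  proof -
    have "pack (nths x (block u i)) = subpack w u i \<longleftrightarrow>
        (\<forall>a<n. \<forall>b<n. u ! a = i \<longrightarrow> u ! b = i \<longrightarrow> (x ! a \<le> x ! b \<longleftrightarrow> w ! a \<le> w ! b))" for i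
      using lu lw x by (auto simp: subpack_def nths_block pack_map_eq_iff set_positions)
    \<comment> \<open>Every letter of \<open>u\<close> lies in the range of \<open>i\<close>, so
      each pair of positions in a common block is covered.\<close>
    then show ?thesis using range by metis
  qed
  finally show ?thesis .
qed

section \<open>From counts to polynomial coefficients\<close>

lemma tbinom_poly_of_nat:
  "poly (tbinom k) (of_nat m :: 'k::field_char_0) = of_nat (m choose k)"
  by (simp add: poly_tbinom binomial_gbinomial)

text \<open>In characteristic 0 the natural numbers are infinitely many distinct scalars, too many
  to be roots of a nonzero difference.\<close>

lemma poly_eqI_of_nat:
  fixes p q :: "'k::field_char_0 poly"
  assumes "\<And>m. poly p (of_nat m) = poly q (of_nat m)"
  shows "p = q"
proof (rule ccontr)
  assume "p \<noteq> q"
  then have "finite {x. poly (p - q) x = 0}" by (intro poly_roots_finite) simp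
  moreover have "range of_nat \<subseteq> {x. poly (p - q) x = 0}" using assms by auto
  ultimately have "finite (range (of_nat :: nat \<Rightarrow> 'k))" by (rule finite_subset[rotated])
  then show False using finite_imageD[OF _ inj_of_nat] by blast
qed

text \<open>Double counting at \<open>t = m\<close>: the words \<open>x\<close> with
  \<open>pack (zip u x) = w\<close> are grouped by \<open>pack x\<close> on the left and chosen
  block by block on the right.\<close>

lemma sum_tbinom_pack_zip:
  assumes u: "u \<in> packed_words n" and w: "w \<in> packed_words n" and f: "finer w u"
  shows "(\<Sum>v\<in>{v \<in> packed_words n. pack (zip u v) = w}. tbinom (max_letter v) :: 'k::field_char_0 poly)
    = (\<Prod>i=1..max_letter u. tbinom (max_letter (subpack w u i)))"
proof (rule poly_eqI_of_nat)
  fix m :: nat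
  let ?P = "{v \<in> packed_words n. pack (zip u v) = w}"
  let ?W = "\<lambda>v. {x. set x \<subseteq> {..<m} \<and> pack x = v}"
  have lu: "length u = n" and lw: "length w = n" using u w by (auto simp: packed_words_def)
  have "(\<Sum>v\<in>?P. m choose max_letter v) = (\<Sum>v\<in>?P. card (?W v))"
    by (intro sum.cong) (auto simp: card_words_pack packed_words_def)
  also have "\<dots> = card (\<Union>v\<in>?P. ?W v)"
    by (intro card_UN_disjoint[symmetric]) (auto simp: finite_packed_words finite_words)
  \<comment> \<open>Each such \<open>x\<close> lies in the class of \<open>v = pack x\<close>, which
    is admissible by \<open>pack_packed\<close> and \<open>pack_zip_pack\<close>.\<close>
  also have "(\<Union>v\<in>?P. ?W v) = {x. length x = length u \<and> set x \<subseteq> {..<m} \<and> pack (zip u x) = w}"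
    using lu by (auto simp: packed_words_def pack_packed pack_zip_pack)
  also have "\<dots> = {x. length x = length u \<and> set x \<subseteq> {..<m} \<and>
      (\<forall>i\<in>{1..max_letter u}. pack (nths x (block u i)) = subpack w u i)}"
    using pack_zip_eq_iff[OF u w f] lu by auto
  also have "card \<dots> = (\<Prod>i=1..max_letter u. card (?W (subpack w u i)))"
    using u lu lw set_packed[of u]
    by (intro card_words_blockwise) (auto simp: packed_words_def subpack_def nths_block)
  also have "\<dots> = (\<Prod>i=1..max_letter u. m choose max_letter (subpack w u i))"
    by (simp add: card_words_pack subpack_def pack_packed)
  finally have "(\<Sum>v\<in>?P. m choose max_letter v) =
    (\<Prod>i=1..max_letter u. m choose max_letter (subpack w u i))" .
  then have "(of_nat (\<Sum>v\<in>?P. m choose max_letter v) :: 'k) =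
    of_nat (\<Prod>i=1..max_letter u. m choose max_letter (subpack w u i))" by (rule arg_cong)
  then show "poly (\<Sum>v\<in>?P. tbinom (max_letter v)) (of_nat m :: 'k) =
    poly (\<Prod>i=1..max_letter u. tbinom (max_letter (subpack w u i))) (of_nat m)"
    by (simp add: poly_sum poly_prod tbinom_poly_of_nat)
qed

text \<open>Kept general in the coefficient ring because it serves both \<open>sigma n\<close> over
  polynomials and \<open>eulerian n k\<close> over the field.\<close>

lemma lookup_iprod_N:
  fixes g :: "nat list \<Rightarrow>\<^sub>0 'a::comm_ring_1"
  assumes g: "g \<in> WQSym n" and u: "length u = n"
  shows "Poly_Mapping.lookup (iprod (N u) g) w =
    (\<Sum>v\<in>{v \<in> packed_words n. pack (zip u v) = w}. Poly_Mapping.lookup g v)"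
proof -
  have k: "Poly_Mapping.keys (N u :: nat list \<Rightarrow>\<^sub>0 'a) = {u}"
    "Poly_Mapping.lookup (N u :: nat list \<Rightarrow>\<^sub>0 'a) u = 1"
    by (simp_all add: N_def)
  have gk: "Poly_Mapping.keys g \<subseteq> packed_words n" using g by (simp add: WQSym_def)
  have "Poly_Mapping.lookup (iprod (N u) g) w =
      (\<Sum>v\<in>Poly_Mapping.keys g. if pack (zip u v) = w then Poly_Mapping.lookup g v else 0)"
    unfolding iprod_def k sum.insert[OF finite.emptyI] sum.empty lookup_sum
    using gk u
    by (auto simp: lookup_sum k(2) lookup_smul N_def lookup_single when_def packed_words_def
        intro!: sum.cong)
  \<comment> \<open>Words outside the support contribute 0; adding them gives an index set that does
    not depend on \<open>g\<close>.\<close>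
  also have "\<dots> = (\<Sum>v\<in>packed_words n. if pack (zip u v) = w then Poly_Mapping.lookup g v else 0)"
    using gk by (intro sum.mono_neutral_left) (auto simp: finite_packed_words in_keys_iff)
  also have "\<dots> = (\<Sum>v\<in>{v \<in> packed_words n. pack (zip u v) = w}. Poly_Mapping.lookup g v)"
    by (simp add: sum.inter_filter finite_packed_words)
  finally show ?thesis .
qed

theorem mainTheorem4:
  fixes u :: "nat list" and n :: nat
  assumes "u \<in> packed_words n" and "n \<ge> 1"
  shows "(V u :: nat list \<Rightarrow>\<^sub>0 'k::field_char_0 poly)
      = (\<Sum>k=1..n. smul (monom 1 k) (ext (iprod (N u) (eulerian n k))))
    \<and> (V u :: nat list \<Rightarrow>\<^sub>0 'k poly)
      = (\<Sum>w\<in>{w \<in> packed_words n. finer w u}.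
           smul (\<Prod>i=1..max_letter u. tbinom (max_letter (subpack w u i))) (N w))"
proof
  have lu: "length u = n" using assms(1) by (simp add: packed_words_def)
  let ?P = "\<lambda>w. {v \<in> packed_words n. pack (zip u v) = w}"
  have V: "Poly_Mapping.lookup (V u :: nat list \<Rightarrow>\<^sub>0 'k poly) w =
      (\<Sum>v\<in>?P w. Poly_Mapping.lookup (sigma n) v)" for w
    unfolding V_def lu by (rule lookup_iprod_N[OF sigma_WQSym lu])
  show "(V u :: nat list \<Rightarrow>\<^sub>0 'k poly)
      = (\<Sum>k=1..n. smul (monom 1 k) (ext (iprod (N u) (eulerian n k))))"
  proof (rule poly_mapping_eqI)
    fix w
    \<comment> \<open>Additivity of the embedding of constants lets \<open>ext\<close> pass through
      the coefficient sum of the product.\<close>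
    have const: "[:\<Sum>v\<in>A. h v:] = (\<Sum>v\<in>A. [:h v:])" for A :: "nat list set" and h :: "nat list \<Rightarrow> 'k"
      by (rule poly_eqI) (simp add: coeff_sum coeff_pCons split: nat.split)
    \<comment> \<open>The coefficient is linear in \<open>sigma n\<close>, so the expansion in
      powers of \<open>t\<close> is inserted and the two sums are exchanged. Here
      \<open>n \<ge> 1\<close> matters: \<open>sigma 0\<close> has a constant term.\<close>
    have "Poly_Mapping.lookup (V u :: nat list \<Rightarrow>\<^sub>0 'k poly) w =
      (\<Sum>v\<in>?P w. \<Sum>k=1..n. monom 1 k * [:Poly_Mapping.lookup (eulerian n k) v:])"
      unfolding V sigma_eulerian[OF assms(2)]
      by (intro sum.cong refl) (simp only: lookup_sum lookup_smul lookup_ext)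
    also have "\<dots> = (\<Sum>k=1..n. monom 1 k * [:\<Sum>v\<in>?P w. Poly_Mapping.lookup (eulerian n k) v:])"
      by (subst sum.swap) (simp only: const sum_distrib_left)
    also have "\<dots> = Poly_Mapping.lookup
        (\<Sum>k=1..n. smul (monom 1 k) (ext (iprod (N u) (eulerian n k)))) w"
      by (simp only: lookup_sum lookup_smul lookup_ext lookup_iprod_N[OF eulerian_WQSym lu])
    finally show "Poly_Mapping.lookup (V u :: nat list \<Rightarrow>\<^sub>0 'k poly) w = \<dots>" .
  qed
  show "(V u :: nat list \<Rightarrow>\<^sub>0 'k poly)
      = (\<Sum>w\<in>{w \<in> packed_words n. finer w u}.
           smul (\<Prod>i=1..max_letter u. tbinom (max_letter (subpack w u i))) (N w))"
  proof (rule poly_mapping_eqI)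
    fix w
    let ?c = "\<lambda>w. \<Prod>i=1..max_letter u. tbinom (max_letter (subpack w u i)) :: 'k poly"
    let ?F = "{w \<in> packed_words n. finer w u}"
    have "Poly_Mapping.lookup (\<Sum>w\<in>?F. smul (?c w) (N w)) w = (\<Sum>v\<in>?F. if v = w then ?c w else 0)"
      unfolding lookup_sum
      by (rule sum.cong) (auto simp: lookup_smul N_def lookup_single when_def)
    also have "\<dots> = (if w \<in> ?F then ?c w else 0)"
      using finite_packed_words[of n] by simp
    also have "\<dots> = (\<Sum>v\<in>?P w. tbinom (max_letter v))"
    proof (cases "w \<in> ?F")
      case True
      then show ?thesis using sum_tbinom_pack_zip[OF assms(1), of w, where 'k = 'k] by simp
    next
      case False
      \<comment> \<open>Every word arising as a product is packed and finer than \<open>u\<close>;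
        for any other \<open>w\<close> the sum is empty.\<close>
      have "w \<in> ?F" if "v \<in> ?P w" for v
        using that finer_pack_zip[OF assms(1), of v] lu pack_packed[of "zip u v"]
        by (auto simp: packed_words_def)
      with False have "?P w = {}" by blast
      with False show ?thesis by (simp only: if_False sum.empty)
    qed
    also have "\<dots> = Poly_Mapping.lookup (V u) w"
      unfolding V by (intro sum.cong) (auto simp: lookup_sigma)
    finally show "Poly_Mapping.lookup (V u) w = Poly_Mapping.lookup (\<Sum>w\<in>?F. smul (?c w) (N w)) w" ..
  qed
qed

end
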